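(* Let $k \ge 1$ and $d > h \ge 2$ be positive integers and let $G = (U,V,E)$ be a bipartite graph. Suppose that $d(u) \le d$ for all $u \in U$ and, for all $S \subseteq U$, $$|\Gamma(S)| \ge \left(h-1+\frac{d-h+1}{k+1+(d-h-1)\lceil k/h \rceil}\right)|S|.$$ Then $G$ has an $(h,hk)$-matching.
   Context: All graphs are finite and simple. $G=(U,V,E)$ denotes a bipartite graph with left vertex class $U$, right vertex class $V$ and edge set $E$; $d(u)$ is the degree of the vertex $u$ in $G$. For a set $S$ of vertices, $\Gamma(S)$ denotes the set of vertices adjacent to at least one vertex of $S$. For positive integers $t \ge s$, an $(s,t)$-matching in $G=(U,V,E)$ is a subset $F \subseteq E$ such that, in the graph $H=(U,V,F)$, each connected component is a tree with at most $t$ edges, and every $u \in U$ has degree $d_H(u)=s$. *)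

theory Defs
  imports Complex_Main
begin

text \<open>
  A finite simple graph is given by a finite vertex set together with a set of edges, each edge
  being a two-element set of vertices.  (The notion of \<open>tree\<close> in the AFP entry
  Graph_Theory is not used: it excludes directed cycles, so the two opposite arcs
  representing an undirected edge already form a cycle there.)
\<close>

definition bipartite_graph :: "'a set \<Rightarrow> 'a set \<Rightarrow> 'a set set \<Rightarrow> bool" where
  "bipartite_graph U V E \<longleftrightarrow>
     finite U \<and> finite V \<and> U \<inter> V = {} \<and> E \<subseteq> {{u, v} | u v. u \<in> U \<and> v \<in> V}"

definition degree :: "'a set set \<Rightarrow> 'a \<Rightarrow> nat" where
  "degree E x = card {e \<in> E. x \<in> e}"

definition neighbours :: "'a set set \<Rightarrow> 'a set \<Rightarrow> 'a set" where
  "neighbours E S = {y. \<exists>x \<in> S. {x, y} \<in> E}"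

definition adj_rel :: "'a set set \<Rightarrow> ('a \<times> 'a) set" where
  "adj_rel E = {(x, y). {x, y} \<in> E}"

definition connected_graph :: "'a set \<Rightarrow> 'a set set \<Rightarrow> bool" where
  "connected_graph W E \<longleftrightarrow> W \<noteq> {} \<and> (\<forall>x \<in> W. \<forall>y \<in> W. (x, y) \<in> (adj_rel E)\<^sup>*)"

text \<open>
  A cycle is listed by its vertices, without repeating the first one at the end.
\<close>

definition is_cycle :: "'a set set \<Rightarrow> 'a list \<Rightarrow> bool" where
  "is_cycle E c \<longleftrightarrow> length c \<ge> 3 \<and> distinct c \<and>
     (\<forall>i < length c. {c ! i, c ! (Suc i mod length c)} \<in> E)"

definition is_tree :: "'a set \<Rightarrow> 'a set set \<Rightarrow> bool" where
  "is_tree W E \<longleftrightarrow> connected_graph W E \<and> (\<nexists>c. is_cycle E c)"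

text \<open>
  The vertex sets of the connected components of \<open>(W, E)\<close>, for edges contained in \<open>W\<close>.
  A vertex without incident edges forms a component of its own.
\<close>

definition components :: "'a set \<Rightarrow> 'a set set \<Rightarrow> 'a set set" where
  "components W E = {(adj_rel E)\<^sup>* `` {x} | x. x \<in> W}"

definition edges_within :: "'a set set \<Rightarrow> 'a set \<Rightarrow> 'a set set" where
  "edges_within E C = {e \<in> E. e \<subseteq> C}"

text \<open>
  \<open>is_matching U V E s t F\<close>: \<open>F\<close> is an \<open>(s, t)\<close>-matching in \<open>(U, V, E)\<close>; the notion is meant for
  positive integers \<open>s \<le> t\<close>.
\<close>

definition is_matching ::
  "'a set \<Rightarrow> 'a set \<Rightarrow> 'a set set \<Rightarrow> nat \<Rightarrow> nat \<Rightarrow> 'a set set \<Rightarrow> bool" where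
  "is_matching U V E s t F \<longleftrightarrow> F \<subseteq> E \<and>
     (\<forall>C \<in> components (U \<union> V) F.
        is_tree C (edges_within F C) \<and> card (edges_within F C) \<le> t) \<and>
     (\<forall>u \<in> U. degree F u = s)"

end

theory Submission
  imports Defs
begin

text \<open>
  Let \<open>q = \<lceil>k / h\<rceil>\<close> and let \<open>h - 1 + \<beta>\<close> be the expansion factor.  By the fractional form of Hall's
  theorem every vertex of \<open>U\<close> can send \<open>h - 1 + \<beta>\<close> units to its neighbours so that no vertex of \<open>V\<close>
  receives more than \<open>1\<close>, and the edges used can be taken to form a forest; root its trees.  Every
  \<open>u\<close> uses at least \<open>h\<close> edges.  If it uses exactly \<open>h\<close>, keep them all; if it uses more, drop the
  edge to its parent and keep \<open>h\<close> child edges with the smallest branches, where a branch extends only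
  through vertices of \<open>U\<close> that use exactly \<open>h\<close> edges.  Comparing flow with capacity, a branch with
  \<open>j\<close> vertices of \<open>U\<close> hanging on an edge of weight \<open>y\<close> satisfies \<open>\<beta> j \<le> 1 - y\<close>.  If the
  component below \<open>u\<close> had more than \<open>k\<close> vertices of \<open>U\<close>, then the largest kept branch and all dropped
  ones would have at least \<open>q\<close> of them, and summing these bounds contradicts the value of \<open>\<beta>\<close>.
\<close>

section \<open>Forests via vertex rankings\<close>

text \<open>The lower-ranked neighbour of a vertex acts as its parent, so a ranking is a rooted
  orientation in which every vertex has at most one parent.\<close>

definition ranked :: "'a set set \<Rightarrow> ('a \<Rightarrow> nat) \<Rightarrow> bool" where
  "ranked T r \<longleftrightarrow> (\<forall>x y. {x, y} \<in> T \<longrightarrow> r x \<noteq> r y) \<and>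
     (\<forall>x y z. {x, y} \<in> T \<and> {x, z} \<in> T \<and> r y < r x \<and> r z < r x \<longrightarrow> y = z)"

text \<open>The quantifier over \<open>w\<close> lets any vertex be made a root. This freedom of
  rerooting is what makes \<open>forest_join\<close> provable.\<close>

definition forest :: "'a set set \<Rightarrow> bool" where
  "forest T \<longleftrightarrow> (\<forall>w. \<exists>r. ranked T r \<and> (\<forall>y. {w, y} \<in> T \<longrightarrow> r w < r y))"

lemma ranked_mono: "ranked T r \<Longrightarrow> T' \<subseteq> T \<Longrightarrow> ranked T' r"
  unfolding ranked_def by blast

lemma ranked_neq: "ranked T r \<Longrightarrow> {x, y} \<in> T \<Longrightarrow> r x \<noteq> r y"
  unfolding ranked_def by blast

lemma ranked_unique:
  "ranked T r \<Longrightarrow> {x, y} \<in> T \<Longrightarrow> {x, z} \<in> T \<Longrightarrow> r y < r x \<Longrightarrow> r z < r x \<Longrightarrow> y = z"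
  unfolding ranked_def by blast

lemma forest_mono: "forest T \<Longrightarrow> T' \<subseteq> T \<Longrightarrow> forest T'"
  unfolding forest_def using ranked_mono by (metis subsetD)

lemma forest_empty: "forest {}"
  by (simp add: forest_def ranked_def)

text \<open>A vertex of greatest rank on a cycle would have both of its cycle neighbours below it,
  that is, two distinct parents.\<close>

lemma ranked_no_cycle:
  assumes "ranked T r"
  shows "\<not> is_cycle T c"
proof
  assume cyc: "is_cycle T c"
  define n where "n = length c"
  have n: "n \<ge> 3" and dist: "distinct c"
    and edge: "\<And>i. i < n \<Longrightarrow> {c ! i, c ! (Suc i mod n)} \<in> T"
    using cyc by (auto simp: is_cycle_def n_def)
  have "\<exists>i<n. \<forall>j<n. r (c ! j) \<le> r (c ! i)"
  proof -
    have "finite {..<n}" "0 \<in> {..<n}" using n by auto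
    then obtain i where "i \<in> {..<n}" "r (c ! i) = Max ((\<lambda>j. r (c ! j)) ` {..<n})"
      using Max_in[of "(\<lambda>j. r (c ! j)) ` {..<n}"] by fastforce
    then show ?thesis by (intro exI[of _ i]) auto
  qed
  then obtain i where i: "i < n" and max: "\<And>j. j < n \<Longrightarrow> r (c ! j) \<le> r (c ! i)" by blast
  define p where "p = (if i = 0 then n - 1 else i - 1)"
  define s where "s = Suc i mod n"
  have p: "p < n" "Suc p mod n = i" using i n by (auto simp: p_def)
  have s: "s < n" using n by (simp add: s_def)
  \<comment> \<open>Length at least 3 is what separates the predecessor of \<open>i\<close> from its
    successor.\<close>
  have ps: "p \<noteq> s"
  proof (cases "Suc i = n")
    case True then show ?thesis using n by (auto simp: p_def s_def)
  next
    case False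
    then have "s = Suc i" using i by (simp add: s_def)
    then show ?thesis using n by (auto simp: p_def)
  qed
  have e: "{c ! i, c ! p} \<in> T" "{c ! i, c ! s} \<in> T"
    using edge[OF p(1)] edge[OF i] p(2) by (auto simp: s_def insert_commute)
  have "r (c ! p) < r (c ! i)" "r (c ! s) < r (c ! i)"
    using e max[OF p(1)] max[OF s] assms unfolding ranked_def
    by (metis le_neq_implies_less)+
  then have "c ! p = c ! s" using e assms unfolding ranked_def by blast
  then show False using dist p(1) s ps by (simp add: n_def nth_eq_iff_index_eq)
qed

text \<open>Root one forest at the prescribed vertex and the other at its end of the new edge, then
  lift the second above the first: the new edge becomes the parent edge of that end.\<close>

lemma forest_join:
  assumes "forest S" "forest T" "\<Union>S \<subseteq> A" "\<Union>T \<subseteq> B" "A \<inter> B = {}" "a \<in> A" "b \<in> B"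
  shows "forest (S \<union> T \<union> {{a, b}})"
proof -
  \<comment> \<open>Only roots \<open>w\<close> outside \<open>B\<close> are treated; exchanging the
    two forests gives the rest.\<close>
  have key: "\<exists>r. ranked (S \<union> T \<union> {{a, b}}) r \<and> (\<forall>y. {w, y} \<in> S \<union> T \<union> {{a, b}} \<longrightarrow> r w < r y)"
    if "forest S" "forest T" "\<Union>S \<subseteq> A" "\<Union>T \<subseteq> B" "A \<inter> B = {}" "a \<in> A" "b \<in> B" "w \<notin> B"
    for S T :: "'a set set" and A B a b w
  proof -
    obtain r1 where r1: "ranked S r1" "\<And>y. {w, y} \<in> S \<Longrightarrow> r1 w < r1 y"
      using \<open>forest S\<close> unfolding forest_def by blast
    obtain r2 where r2: "ranked T r2" "\<And>y. {b, y} \<in> T \<Longrightarrow> r2 b < r2 y"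
      using \<open>forest T\<close> unfolding forest_def by blast
    \<comment> \<open>The shift puts \<open>b\<close> just above \<open>a\<close> or higher. As
      \<open>b\<close> is lowest among its neighbours in \<open>T\<close>, its only parent is now
      \<open>a\<close>, and \<open>a\<close> gains only a child.\<close>
    define r where "r z = (if z \<in> B then r2 z + Suc (r1 a) else r1 z)" for z
    have mS: "x \<notin> B \<and> y \<notin> B" if "{x, y} \<in> S" for x y
      using that \<open>\<Union>S \<subseteq> A\<close> \<open>A \<inter> B = {}\<close> by blast
    have mT: "x \<in> B \<and> y \<in> B" if "{x, y} \<in> T" for x y
      using that \<open>\<Union>T \<subseteq> B\<close> by blast
    have a: "a \<notin> B" using that by blast
    have cases: "({x, y} \<in> S \<and> x \<notin> B \<and> y \<notin> B) \<or> ({x, y} \<in> T \<and> x \<in> B \<and> y \<in> B)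
        \<or> x = a \<and> y = b \<or> x = b \<and> y = a"
      if "{x, y} \<in> S \<union> T \<union> {{a, b}}" for x y
      using that mS mT by (auto simp: doubleton_eq_iff)
    have neq: "r x \<noteq> r y" if "{x, y} \<in> S \<union> T \<union> {{a, b}}" for x y
      using cases[OF that] r1(1) r2(1) a \<open>b \<in> B\<close> unfolding ranked_def r_def by auto
    have uniq: "y = z"
      if "{x, y} \<in> S \<union> T \<union> {{a, b}}" "{x, z} \<in> S \<union> T \<union> {{a, b}}" "r y < r x" "r z < r x"
      for x y z
    proof -
      have lowb: False if "{b, y'} \<in> T" "r2 y' < r2 b" for y'
        using r2(2)[OF that(1)] that(2) by simp
      show ?thesis
        using cases[OF that(1)] cases[OF that(2)] that(3,4) r1(1) r2(1) a \<open>b \<in> B\<close> lowb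
        unfolding ranked_def r_def by (auto split: if_splits)
    qed
    have "r w < r y" if "{w, y} \<in> S \<union> T \<union> {{a, b}}" for y
      using cases[OF that] r1(2) \<open>w \<notin> B\<close> a \<open>b \<in> B\<close> unfolding r_def by auto
    moreover have "ranked (S \<union> T \<union> {{a, b}}) r"
      unfolding ranked_def
    proof (intro conjI allI impI)
      show "r x \<noteq> r y" if "{x, y} \<in> S \<union> T \<union> {{a, b}}" for x y
        using neq[OF that] .
      show "y = z" if "{x, y} \<in> S \<union> T \<union> {{a, b}} \<and> {x, z} \<in> S \<union> T \<union> {{a, b}} \<and>
          r y < r x \<and> r z < r x" for x y z
        using that by (elim conjE) (rule uniq)
    qed
    ultimately show ?thesis by blast
  qed
  show ?thesis unfolding forest_def
  proof
    fix w
    show "\<exists>r. ranked (S \<union> T \<union> {{a, b}}) r \<and> (\<forall>y. {w, y} \<in> S \<union> T \<union> {{a, b}} \<longrightarrow> r w < r y)"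
    proof (cases "w \<in> B")
      case False
      then show ?thesis using key[of S T A B a b w] assms by blast
    next
      case True
      then have "w \<notin> A" using assms by blast
      moreover have "T \<union> S \<union> {{b, a}} = S \<union> T \<union> {{a, b}}" by (auto simp: insert_commute)
      ultimately show ?thesis using key[of T S B A b a w] assms by (metis Int_commute)
    qed
  qed
qed

lemma component_connected:
  assumes "C \<in> components W F"
  shows "connected_graph C (edges_within F C)"
proof -
  obtain x where C: "C = (adj_rel F)\<^sup>* `` {x}" using assms by (auto simp: components_def)
  let ?R = "adj_rel (edges_within F C)"
  have reach: "(x, y) \<in> ?R\<^sup>*" if "(x, y) \<in> (adj_rel F)\<^sup>*" for y
    using that
  proof (induction rule: rtrancl_induct)
    case (step y z)
    then have "y \<in> C" "z \<in> C" by (auto simp: C intro: rtrancl_into_rtrancl)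
    then have "(y, z) \<in> ?R" using step(2) by (simp add: adj_rel_def edges_within_def)
    then show ?case using step.IH by simp
  qed simp
  have "sym ?R" by (auto simp: sym_def adj_rel_def insert_commute)
  then have "sym (?R\<^sup>*)" by (rule sym_rtrancl)
  then have "(y, z) \<in> ?R\<^sup>*" if "y \<in> C" "z \<in> C" for y z
  proof -
    have "(x, y) \<in> ?R\<^sup>*" "(x, z) \<in> ?R\<^sup>*" using that reach by (simp_all add: C)
    then show ?thesis using \<open>sym (?R\<^sup>*)\<close> by (meson rtrancl_trans symE)
  qed
  moreover have "x \<in> C" by (simp add: C)
  ultimately show ?thesis unfolding connected_graph_def by blast
qed

section \<open>Fractional assignments supported on a forest\<close>

text \<open>The weighted Hall condition of a transportation problem with demands \<open>a\<close> on
  \<open>U\<close> and capacities \<open>c\<close> on \<open>V\<close>.\<close>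

definition hall_cond ::
  "('a \<Rightarrow> 'a \<Rightarrow> bool) \<Rightarrow> 'a set \<Rightarrow> 'a set \<Rightarrow> ('a \<Rightarrow> real) \<Rightarrow> ('a \<Rightarrow> real) \<Rightarrow> bool" where
  "hall_cond N U V a c \<longleftrightarrow> (\<forall>u\<in>U. 0 \<le> a u) \<and> (\<forall>v\<in>V. 0 \<le> c v) \<and>
     (\<forall>S\<subseteq>U. sum a S \<le> sum c {v \<in> V. \<exists>u\<in>S. N u v})"

lemma hall_condI:
  assumes "\<And>u. u \<in> U \<Longrightarrow> 0 \<le> a u" "\<And>v. v \<in> V \<Longrightarrow> 0 \<le> c v"
    and "\<And>S. S \<subseteq> U \<Longrightarrow> sum a S \<le> sum c {v \<in> V. \<exists>u\<in>S. N u v}"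
  shows "hall_cond N U V a c"
  using assms unfolding hall_cond_def by blast

text \<open>The first two conditions range over all pairs, so \<open>x\<close> vanishes off the
  given edges and flows on disjoint parts can simply be added.\<close>

definition forest_flow ::
  "('a \<Rightarrow> 'a \<Rightarrow> bool) \<Rightarrow> 'a set \<Rightarrow> 'a set \<Rightarrow> ('a \<Rightarrow> real) \<Rightarrow> ('a \<Rightarrow> real) \<Rightarrow>
    ('a \<Rightarrow> 'a \<Rightarrow> real) \<Rightarrow> bool" where
  "forest_flow N U V a c x \<longleftrightarrow> (\<forall>u v. 0 \<le> x u v) \<and>
     (\<forall>u v. 0 < x u v \<longrightarrow> u \<in> U \<and> v \<in> V \<and> N u v) \<and>
     (\<forall>u\<in>U. (\<Sum>v\<in>V. x u v) = a u) \<and> (\<forall>v\<in>V. (\<Sum>u\<in>U. x u v) \<le> c v) \<and>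
     forest {{u, v} | u v. 0 < x u v}"

text \<open>The edge carrying \<open>t\<close> has \<open>v\<close> in the first part and
  \<open>u\<close> in the second. The parts share no vertex, so this edge joins two disjoint
  forests, and it restores the \<open>t\<close> taken from the demand of \<open>u\<close> and the
  capacity of \<open>v\<close>.\<close>

lemma forest_flow_glue:
  assumes fin: "finite U" "finite V" and disj: "U \<inter> V = {}"
    and sub: "U1 \<subseteq> U" "V1 \<subseteq> V" and u: "u \<in> U - U1" and v: "v \<in> V1" and N: "N u v"
    and t: "0 \<le> t"
    and x1: "forest_flow N U1 V1 (a(u := a u - t)) (c(v := c v - t)) x1"
    and x2: "forest_flow N (U - U1) (V - V1) (a(u := a u - t)) (c(v := c v - t)) x2"
  shows "forest_flow N U V a c
           (\<lambda>p q. x1 p q + x2 p q + (if p = u \<and> q = v then t else 0))"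
    (is "forest_flow N U V a c ?x")
proof -
  have z1: "x1 p q = 0" if "p \<notin> U1 \<or> q \<notin> V1" for p q
    using x1 that unfolding forest_flow_def by (metis less_eq_real_def)
  have z2: "x2 p q = 0" if "p \<notin> U - U1 \<or> q \<notin> V - V1" for p q
    using x2 that unfolding forest_flow_def by (metis less_eq_real_def)
  have row1: "(\<Sum>q\<in>V1. x1 p q) = a p" if "p \<in> U1" for p
    using x1 that u unfolding forest_flow_def by fastforce
  have row2: "(\<Sum>q\<in>V-V1. x2 p q) = (a(u := a u - t)) p" if "p \<in> U - U1" for p
    using x2 that unfolding forest_flow_def by blast
  have col1: "(\<Sum>p\<in>U1. x1 p q) \<le> (c(v := c v - t)) q" if "q \<in> V1" for q
    using x1 that unfolding forest_flow_def by blast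
  have col2: "(\<Sum>p\<in>U-U1. x2 p q) \<le> (c(v := c v - t)) q" if "q \<in> V - V1" for q
    using x2 that unfolding forest_flow_def by blast
  have uV: "u \<in> U" "v \<in> V" using u v sub by auto
  have nonneg: "0 \<le> ?x p q" for p q
    using x1 x2 t unfolding forest_flow_def by auto
  have supp: "0 < x1 p q \<or> 0 < x2 p q \<or> p = u \<and> q = v" if "0 < ?x p q" for p q
    using that by (smt (verit) t)
  have inU: "p \<in> U \<and> q \<in> V \<and> N p q" if "0 < ?x p q" for p q
    using supp[OF that] x1 x2 sub uV N unfolding forest_flow_def by blast
  have row: "(\<Sum>q\<in>V. ?x p q) = a p" if p: "p \<in> U" for p
  proof -
    have s1: "(\<Sum>q\<in>V. x1 p q) = (\<Sum>q\<in>V1. x1 p q)"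
      by (rule sum.mono_neutral_right) (use fin sub z1 in auto)
    have s2: "(\<Sum>q\<in>V. x2 p q) = (\<Sum>q\<in>V-V1. x2 p q)"
      by (rule sum.mono_neutral_right) (use fin sub z2 in auto)
    have s3: "(\<Sum>q\<in>V. if p = u \<and> q = v then t else 0) = (if p = u then t else 0)"
      using fin uV by (cases "p = u") auto
    have "(\<Sum>q\<in>V. ?x p q) = (\<Sum>q\<in>V1. x1 p q) + (\<Sum>q\<in>V-V1. x2 p q) + (if p = u then t else 0)"
      by (simp add: sum.distrib s1 s2 s3)
    moreover have "(\<Sum>q\<in>V1. x1 p q) = (if p \<in> U1 then a p else 0)"
      using row1 z1 by auto
    moreover have "(\<Sum>q\<in>V-V1. x2 p q) = (if p \<in> U1 then 0 else a p - (if p = u then t else 0))"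
      using row2 z2 p by auto
    ultimately show ?thesis using u by auto
  qed
  have col: "(\<Sum>p\<in>U. ?x p q) \<le> c q" if q: "q \<in> V" for q
  proof -
    have s1: "(\<Sum>p\<in>U. x1 p q) = (\<Sum>p\<in>U1. x1 p q)"
      by (rule sum.mono_neutral_right) (use fin sub z1 in auto)
    have s2: "(\<Sum>p\<in>U. x2 p q) = (\<Sum>p\<in>U-U1. x2 p q)"
      by (rule sum.mono_neutral_right) (use fin sub z2 in auto)
    have s3: "(\<Sum>p\<in>U. if p = u \<and> q = v then t else 0) = (if q = v then t else 0)"
      using fin uV by (cases "q = v") auto
    have eq: "(\<Sum>p\<in>U. ?x p q) = (\<Sum>p\<in>U1. x1 p q) + (\<Sum>p\<in>U-U1. x2 p q) + (if q = v then t else 0)"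
      by (simp add: sum.distrib s1 s2 s3)
    show ?thesis
    proof (cases "q \<in> V1")
      case True
      then have "(\<Sum>p\<in>U1. x1 p q) \<le> (c(v := c v - t)) q"
        by (rule col1)
      moreover have "(\<Sum>p\<in>U-U1. x2 p q) = 0" using z2 True by auto
      ultimately show ?thesis unfolding eq by (auto split: if_splits)
    next
      case False
      then have "(\<Sum>p\<in>U-U1. x2 p q) \<le> (c(v := c v - t)) q"
        using q by (intro col2) auto
      moreover have "(\<Sum>p\<in>U1. x1 p q) = 0" using z1 False by auto
      ultimately show ?thesis unfolding eq using False v by (auto split: if_splits)
    qed
  qed
  have "forest {{p, q} | p q. 0 < ?x p q}"
  proof -
    let ?S = "{{p, q} | p q. 0 < x1 p q}" and ?T = "{{p, q} | p q. 0 < x2 p q}"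
    have "\<Union>?S \<subseteq> U1 \<union> V1" using x1 unfolding forest_flow_def by blast
    moreover have "\<Union>?T \<subseteq> (U - U1) \<union> (V - V1)" using x2 unfolding forest_flow_def by blast
    moreover have "(U1 \<union> V1) \<inter> ((U - U1) \<union> (V - V1)) = {}" using disj sub by blast
    ultimately have "forest (?S \<union> ?T \<union> {{v, u}})"
      using forest_join[of ?S ?T "U1 \<union> V1" "(U - U1) \<union> (V - V1)" v u] x1 x2 u v
      unfolding forest_flow_def by blast
    then show ?thesis
    proof (rule forest_mono)
      show "{{p, q} | p q. 0 < ?x p q} \<subseteq> ?S \<union> ?T \<union> {{v, u}}"
      proof
        fix e assume "e \<in> {{p, q} | p q. 0 < ?x p q}"
        then obtain p q where e: "e = {p, q}" "0 < ?x p q" by blast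
        show "e \<in> ?S \<union> ?T \<union> {{v, u}}" using supp[OF e(2)] e(1) by (auto simp: insert_commute)
      qed
    qed
  qed
  then show ?thesis using nonneg inU row col unfolding forest_flow_def by blast
qed

text \<open>
  Push as much flow as possible along one edge.  What stops the increase is an exhausted demand,
  an exhausted capacity, or a tight set, and each splits the problem into two smaller ones joined
  only by this edge; so the support stays a forest.
\<close>

lemma forest_flow_exists:
  assumes "finite U" "finite V" "U \<inter> V = {}" "hall_cond N U V a c"
  shows "\<exists>x. forest_flow N U V a c x"
  using assms
proof (induction "card U + card V" arbitrary: U V a c rule: less_induct)
  case less
  note finU = \<open>finite U\<close> and finV = \<open>finite V\<close>
  note H = \<open>hall_cond N U V a c\<close>
  define \<Gamma> where "\<Gamma> S = {v \<in> V. \<exists>u\<in>S. N u v}" for S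
  have a0: "0 \<le> a u" if "u \<in> U" for u using H that by (simp add: hall_cond_def)
  have c0: "0 \<le> c v" if "v \<in> V" for v using H that by (simp add: hall_cond_def)
  have hall: "sum a S \<le> sum c (\<Gamma> S)" if "S \<subseteq> U" for S
    using H that by (simp add: hall_cond_def \<Gamma>_def)
  have fin\<Gamma>: "finite (\<Gamma> S)" for S using finV by (simp add: \<Gamma>_def)
  show ?case
  proof (cases "\<exists>u\<in>U. \<exists>v\<in>V. N u v")
    case False
    have "a u = 0" if "u \<in> U" for u
    proof -
      have "\<Gamma> {u} = {}" using False that by (auto simp: \<Gamma>_def)
      then show ?thesis using hall[of "{u}"] that a0[OF that] by simp
    qed
    then have "forest_flow N U V a c (\<lambda>_ _. 0)"
      using c0 forest_empty by (simp add: forest_flow_def)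
    then show ?thesis by blast
  next
    case True
    then obtain u v where uv: "u \<in> U" "v \<in> V" "N u v" by blast
    \<comment> \<open>All upper limits for the flow on the edge. Only a set that avoids
      \<open>u\<close> but has \<open>v\<close> as a neighbour loses capacity without losing demand,
      so only its slack counts.\<close>
    define M where "M = {a u, c v} \<union> (\<lambda>S. sum c (\<Gamma> S) - sum a S) ` {S. S \<subseteq> U - {u} \<and> v \<in> \<Gamma> S}"
    define t where "t = Min M"
    have finM: "finite M" using finU by (auto simp: M_def)
    have tM: "t \<in> M" unfolding t_def by (rule Min_in) (use finM in \<open>auto simp: M_def\<close>)
    have tle: "t \<le> m" if "m \<in> M" for m using that finM by (simp add: t_def)
    have t0: "0 \<le> t"
    proof -
      have "0 \<le> m" if m: "m \<in> M" for m
      proof -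
        consider "m = a u" | "m = c v" | S where "S \<subseteq> U" "m = sum c (\<Gamma> S) - sum a S"
          using m by (auto simp: M_def)
        then show ?thesis using a0[OF uv(1)] c0[OF uv(2)] hall by cases auto
      qed
      then show ?thesis using tM by blast
    qed
    define a' where "a' = a(u := a u - t)"
    define c' where "c' = c(v := c v - t)"
    have a'0: "0 \<le> a' p" if "p \<in> U" for p
      using that a0 tle[of "a u"] by (auto simp: a'_def M_def)
    have c'0: "0 \<le> c' q" if "q \<in> V" for q
      using that c0 tle[of "c v"] by (auto simp: c'_def M_def)
    have suma: "sum a' S = sum a S - (if u \<in> S then t else 0)" if "S \<subseteq> U" for S
    proof -
      have "a' = (\<lambda>p. a p - (if p = u then t else 0))" by (auto simp: a'_def)
      then show ?thesis using finite_subset[OF that finU] by (simp add: sum_subtractf)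
    qed
    have sumc: "sum c' T = sum c T - (if v \<in> T then t else 0)" if "T \<subseteq> V" for T
    proof -
      have "c' = (\<lambda>p. c p - (if p = v then t else 0))" by (auto simp: c'_def)
      then show ?thesis using finite_subset[OF that finV] by (simp add: sum_subtractf)
    qed
    have \<Gamma>V: "\<Gamma> S \<subseteq> V" for S by (auto simp: \<Gamma>_def)
    have hall': "sum a' S \<le> sum c' (\<Gamma> S)" if S: "S \<subseteq> U" for S
    proof (cases "u \<in> S")
      case True
      then have "v \<in> \<Gamma> S" using uv by (auto simp: \<Gamma>_def)
      then show ?thesis using True hall[OF S] suma[OF S] sumc[OF \<Gamma>V] by simp
    next
      case False
      show ?thesis
      proof (cases "v \<in> \<Gamma> S")
        case True
        then have "sum c (\<Gamma> S) - sum a S \<in> M" using False S by (auto simp: M_def)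
        then show ?thesis using True False tle suma[OF S] sumc[OF \<Gamma>V] by fastforce
      next
        case nv: False
        then show ?thesis using False hall[OF S] suma[OF S] sumc[OF \<Gamma>V] by simp
      qed
    qed
    have "\<exists>U1 V1. U1 \<subseteq> U \<and> V1 \<subseteq> V \<and> u \<notin> U1 \<and> v \<in> V1 \<and>
        hall_cond N U1 V1 a' c' \<and> hall_cond N (U - U1) (V - V1) a' c'"
    proof -
      have "t = a u \<or> t = c v \<or>
          (\<exists>S. S \<subseteq> U - {u} \<and> v \<in> \<Gamma> S \<and> t = sum c (\<Gamma> S) - sum a S)"
        using tM by (auto simp: M_def)
      then consider "t = a u" | "t = c v" |
        S where "S \<subseteq> U - {u}" "v \<in> \<Gamma> S" "t = sum c (\<Gamma> S) - sum a S" by blast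
      then show ?thesis
      proof cases
        \<comment> \<open>The vertex \<open>u\<close> has no demand left and can be split off with
          no capacity at all.\<close>
        case 1
        have "hall_cond N (U - {u}) V a' c'"
          by (rule hall_condI) (use a'0 c'0 hall'[unfolded \<Gamma>_def] in blast)+
        moreover have "hall_cond N (U - (U - {u})) (V - V) a' c'"
        proof -
          have "U - (U - {u}) = {u}" "a' u = 0" using uv 1 by (auto simp: a'_def)
          then show ?thesis by (intro hall_condI) (auto simp: subset_singleton_iff)
        qed
        ultimately show ?thesis using uv
          by (intro exI[of _ "U - {u}"] exI[of _ V] conjI) blast+
      next
        case 2
        \<comment> \<open>The remaining capacity of \<open>v\<close> is zero, so deleting
          \<open>v\<close> changes no neighbourhood sum.\<close>
        have "sum c' {q \<in> V - {v}. \<exists>p\<in>S. N p q} = sum c' (\<Gamma> S)" for S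
          by (rule sum.mono_neutral_left) (use fin\<Gamma> 2 in \<open>auto simp: \<Gamma>_def c'_def\<close>)
        then have "hall_cond N U (V - {v}) a' c'"
          by (intro hall_condI) (use a'0 c'0 hall' in auto)
        then have "hall_cond N (U - {}) (V - {v}) a' c'" by simp
        moreover have "hall_cond N {} {v} a' c'"
          by (rule hall_condI) (use c'0[OF uv(2)] in auto)
        ultimately show ?thesis using uv
          by (intro exI[of _ "{}"] exI[of _ "{v}"] conjI) blast+
      next
        case 3
        have SU: "S \<subseteq> U" using 3 by blast
        have tight: "sum c' (\<Gamma> S) = sum a' S"
          using 3 suma[OF SU] sumc[OF \<Gamma>V[of S]] by auto
        have h1: "hall_cond N S (\<Gamma> S) a' c'"
        proof (rule hall_condI)
          fix W assume W: "W \<subseteq> S"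
          then have "{q \<in> \<Gamma> S. \<exists>p\<in>W. N p q} = \<Gamma> W" by (auto simp: \<Gamma>_def)
          then show "sum a' W \<le> sum c' {q \<in> \<Gamma> S. \<exists>p\<in>W. N p q}"
            using hall'[of W] W SU by simp
        qed (use a'0 c'0 SU \<Gamma>V in blast)+
        \<comment> \<open>Since \<open>S\<close> consumes all of \<open>\<Gamma> S\<close>, Hall's
          condition for \<open>W \<union> S\<close> leaves enough capacity for \<open>W\<close>
          outside \<open>\<Gamma> S\<close>.\<close>
        have "sum a' W \<le> sum c' {q \<in> V - \<Gamma> S. \<exists>p\<in>W. N p q}" if W: "W \<subseteq> U - S" for W
        proof -
          have "sum a' W + sum a' S = sum a' (W \<union> S)"
            by (rule sum.union_disjoint[symmetric])
              (use W SU finU in \<open>auto intro: finite_subset\<close>)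
          also have "\<dots> \<le> sum c' (\<Gamma> (W \<union> S))" using W SU by (intro hall') auto
          also have "\<Gamma> (W \<union> S) = {q \<in> V - \<Gamma> S. \<exists>p\<in>W. N p q} \<union> \<Gamma> S"
            by (auto simp: \<Gamma>_def)
          also have "sum c' \<dots> = sum c' {q \<in> V - \<Gamma> S. \<exists>p\<in>W. N p q} + sum c' (\<Gamma> S)"
            by (rule sum.union_disjoint) (use finV fin\<Gamma> in auto)
          finally show ?thesis using tight by simp
        qed
        then have "hall_cond N (U - S) (V - \<Gamma> S) a' c'"
          by (intro hall_condI) (use a'0 c'0 in auto)
        then show ?thesis using h1 3 SU \<Gamma>V
          by (intro exI[of _ S] exI[of _ "\<Gamma> S"] conjI) blast+
      qed
    qed
    then obtain U1 V1 where p: "U1 \<subseteq> U" "V1 \<subseteq> V" "u \<notin> U1" "v \<in> V1"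
        "hall_cond N U1 V1 a' c'" "hall_cond N (U - U1) (V - V1) a' c'" by blast
    \<comment> \<open>The first part lacks \<open>u\<close> and the second lacks \<open>v\<close>,
      so both are smaller.\<close>
    have "U1 \<subset> U" "V - V1 \<subset> V" "U - U1 \<subseteq> U" using p uv by blast+
    then have "card U1 < card U" "card V1 \<le> card V"
        "card (U - U1) \<le> card U" "card (V - V1) < card V"
      using p(2) finU finV by (simp_all add: psubset_card_mono card_mono)
    then have less: "card U1 + card V1 < card U + card V"
        "card (U - U1) + card (V - V1) < card U + card V" by linarith+
    have "U1 \<inter> V1 = {}" "(U - U1) \<inter> (V - V1) = {}" using p less.prems(3) by blast+
    then obtain x1 x2 where x1: "forest_flow N U1 V1 a' c' x1"
        and x2: "forest_flow N (U - U1) (V - V1) a' c' x2"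
      using less.hyps[OF less(1) finite_subset[OF p(1) finU] finite_subset[OF p(2) finV] _ p(5)]
        less.hyps[OF less(2) finite_Diff[OF finU] finite_Diff[OF finV] _ p(6)] by blast
    have "u \<in> U - U1" using p(3) uv(1) by blast
    then show ?thesis
      using forest_flow_glue[where u = u and v = v and t = t and a = a and c = c and N = N,
          OF finU finV less.prems(3) p(1,2) _ p(4) uv(3) t0 x1[unfolded a'_def c'_def]
            x2[unfolded a'_def c'_def]] by blast
  qed
qed

section \<open>Pruning the forest\<close>

lemma exists_least_subset:
  fixes f :: "'b \<Rightarrow> nat"
  assumes "finite A" "h \<le> card A"
  shows "\<exists>K\<subseteq>A. card K = h \<and> (\<forall>i\<in>K. \<forall>l\<in>A - K. f i \<le> f l)"
  using assms(2)
proof (induction h)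
  case 0
  then show ?case by (intro exI[of _ "{}"]) auto
next
  case (Suc h)
  then obtain K where K: "K \<subseteq> A" "card K = h" "\<forall>i\<in>K. \<forall>l\<in>A - K. f i \<le> f l" by auto
  then have "A - K \<noteq> {}" using Suc.prems by auto
  then obtain m where m: "m \<in> A - K" "\<forall>l\<in>A - K. f m \<le> f l"
    using ex_has_least_nat[of "\<lambda>m. m \<in> A - K" _ f] by blast
  have "card (insert m K) = Suc h"
    using m K finite_subset[OF K(1) assms(1)] by auto
  moreover have "insert m K \<subseteq> A" using K(1) m(1) by blast
  moreover have "\<forall>i\<in>insert m K. \<forall>l\<in>A - insert m K. f i \<le> f l"
    using K(3) m(2) by blast
  ultimately show ?case by blast
qed

text \<open>Take the \<open>h\<close> smallest values. If they add up to at least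
  \<open>k > h * (q - 1)\<close>, one of them is at least \<open>q\<close>, hence so is every value
  left out.\<close>

lemma sum_le_or_total_ge:
  fixes f :: "'b \<Rightarrow> nat"
  assumes fin: "finite A" and h: "h \<le> card A" and q: "h * q < k + h"
  shows "\<exists>K\<subseteq>A. card K = h \<and> (sum f K < k \<or> k + (card A - h) * q \<le> sum f A)"
proof -
  obtain K where K: "K \<subseteq> A" "card K = h" "\<forall>i\<in>K. \<forall>l\<in>A - K. f i \<le> f l"
    using exists_least_subset[OF fin h] by blast
  have "k + (card A - h) * q \<le> sum f A" if ge: "k \<le> sum f K"
  proof -
    have "q \<le> f l" if l: "l \<in> A - K" for l
    proof (rule ccontr)
      assume "\<not> q \<le> f l"
      then have "\<forall>i\<in>K. Suc (f i) \<le> q" using K(3) l by (meson Suc_leI le_less_trans not_le)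
      then have "(\<Sum>i\<in>K. Suc (f i)) \<le> h * q" using sum_bounded_above[of K _ q] K(2) by simp
      then have "sum f K + h \<le> h * q"
        using K(2) by (simp add: sum_Suc)
      then show False using ge q by linarith
    qed
    then have "(card A - h) * q \<le> sum f (A - K)"
      using sum_bounded_below[of "A - K" q f] K(1,2) card_Diff_subset[of K A]
        finite_subset[OF K(1) fin] by simp
    moreover have "sum f A = sum f K + sum f (A - K)"
      using sum.subset_diff[OF K(1) fin, of f] by simp
    ultimately show ?thesis using ge by linarith
  qed
  then have "sum f K < k \<or> k + (card A - h) * q \<le> sum f A" by linarith
  then show ?thesis using K(1,2) by blast
qed

text \<open>
  \<open>x\<close> sends \<open>h - 1 + \<beta>\<close> units from each vertex of \<open>U\<close> and has capacity \<open>1\<close> on \<open>V\<close>;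
  the neighbour of lower rank is the parent in a rooted forest.
\<close>

locale ranked_flow =
  fixes U V :: "'a set" and x :: "'a \<Rightarrow> 'a \<Rightarrow> real" and r :: "'a \<Rightarrow> nat"
    and h k q d :: nat and \<beta> :: real
  assumes fin: "finite U" "finite V" and disj: "U \<inter> V = {}"
    and nonneg: "0 \<le> x u v"
    and supp: "0 < x u v \<Longrightarrow> u \<in> U \<and> v \<in> V"
    and row: "u \<in> U \<Longrightarrow> (\<Sum>v\<in>V. x u v) = real h - 1 + \<beta>"
    and col: "v \<in> V \<Longrightarrow> (\<Sum>u\<in>U. x u v) \<le> 1"
    and ranked: "ranked {{u, v} | u v. 0 < x u v} r"
    and parent_less: "0 < x u v \<Longrightarrow> r v < r u \<Longrightarrow> x u v < 1"
    and deg: "u \<in> U \<Longrightarrow> card {v \<in> V. 0 < x u v} \<le> d"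
    and h: "1 \<le> h" and \<beta>: "0 < \<beta>" "1 < \<beta> * (real k + 1)"
    and q: "1 \<le> q" "h * q < k + h"
    and big: "h < n \<Longrightarrow> n \<le> d \<Longrightarrow>
      real n - real h + 1 \<le> \<beta> * (real k + 1 + (real n - real h - 1) * real q)"
begin

definition N :: "'a \<Rightarrow> 'a set" where
  "N u = {v \<in> V. 0 < x u v}"

definition children :: "'a \<Rightarrow> 'a set" where
  "children u = {v \<in> N u. r u < r v}"

text \<open>Pairs lead from child to parent. Only edges at vertices of \<open>U\<close> with exactly
  \<open>h\<close> neighbours occur: these vertices keep all their edges, so branches can be
  measured before any selection is made.\<close>

definition R :: "('a \<times> 'a) set" where
  "R = {(v, u) | u v. u \<in> U \<and> card (N u) = h \<and> v \<in> N u \<and> r u < r v} \<union>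
       {(u, v) | u v. u \<in> U \<and> card (N u) = h \<and> v \<in> N u \<and> r v < r u}"

text \<open>The part below \<open>w\<close> that hangs together through vertices of \<open>U\<close> with exactly \<open>h\<close> neighbours.\<close>

definition below :: "'a \<Rightarrow> 'a set" where
  "below w = {y. (y, w) \<in> R\<^sup>*}"

section \<open>Parents, children and branches of the rooted forest\<close>

lemma finN: "finite (N u)"
  using fin by (simp add: N_def)

lemma N_V: "N u \<subseteq> V"
  by (auto simp: N_def)

lemma x_le_1: "v \<in> V \<Longrightarrow> u \<in> U \<Longrightarrow> x u v \<le> 1"
  by (rule order_trans[OF member_le_sum col]) (simp_all add: nonneg fin)

lemma rank_neq: "v \<in> N u \<Longrightarrow> r u \<noteq> r v"
  using ranked_neq[OF ranked, of u v] by (auto simp: N_def)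

lemma parent_unique:
  assumes "v \<in> N u" "v' \<in> N u" "r v < r u" "r v' < r u"
  shows "v = v'"
proof -
  have "{u, v} \<in> {{u, v} | u v. 0 < x u v}" "{u, v'} \<in> {{u, v} | u v. 0 < x u v}"
    using assms(1,2) unfolding N_def by blast+
  then show ?thesis using ranked_unique[OF ranked] assms(3,4) by blast
qed

lemma parent_unique':
  assumes "v \<in> N u" "v \<in> N u'" "r u < r v" "r u' < r v"
  shows "u = u'"
proof -
  have "{v, u} \<in> {{u, v} | u v. 0 < x u v}" "{v, u'} \<in> {{u, v} | u v. 0 < x u v}"
    using assms(1,2) insert_commute unfolding N_def by blast+
  then show ?thesis using ranked_unique[OF ranked] assms(3,4) by blast
qed

lemma rowN: "u \<in> U \<Longrightarrow> (\<Sum>v\<in>N u. x u v) = real h - 1 + \<beta>"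
proof -
  assume u: "u \<in> U"
  have "(\<Sum>v\<in>N u. x u v) = (\<Sum>v\<in>V. x u v)"
    by (rule sum.mono_neutral_left) (use fin nonneg in \<open>auto simp: N_def less_le\<close>)
  then show ?thesis using row[OF u] by simp
qed

text \<open>An edge carries at most \<open>1\<close>, and more than \<open>h - 1\<close> units have
  to leave \<open>u\<close>.\<close>

lemma card_N: "u \<in> U \<Longrightarrow> h \<le> card (N u)"
proof -
  assume u: "u \<in> U"
  have "(\<Sum>v\<in>N u. x u v) \<le> real (card (N u))"
    using sum_bounded_above[of "N u" "x u" 1] x_le_1[OF _ u] subsetD[OF N_V[of u]] by simp
  then show ?thesis using rowN[OF u] \<beta> by linarith
qed

lemma children_cases:
  "children u = N u \<or> (\<exists>p\<in>N u. r p < r u \<and> children u = N u - {p})"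
proof (cases "children u = N u")
  case False
  then obtain p where p: "p \<in> N u" "r p < r u"
  proof -
    have "\<exists>p\<in>N u. \<not> r u < r p" using False unfolding children_def by blast
    then show ?thesis using rank_neq that by (meson nat_neq_iff)
  qed
  have "w \<in> children u \<longleftrightarrow> w \<in> N u \<and> w \<noteq> p" for w
    using parent_unique[OF p(1) _ p(2), of w] rank_neq[of w u] p(2)
    by (auto simp: children_def neq_iff)
  then have "children u = N u - {p}" by blast
  then show ?thesis using p by blast
qed simp

lemma R_rank: "(y, w) \<in> R \<Longrightarrow> r w < r y"
  by (auto simp: R_def)

lemma below_rank: "y \<in> below w \<Longrightarrow> y = w \<or> r w < r y"
proof -
  have "(y, w) \<in> R\<^sup>* \<Longrightarrow> y = w \<or> r w < r y"
    by (induction rule: rtrancl_induct) (auto dest: R_rank)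
  then show "y \<in> below w \<Longrightarrow> y = w \<or> r w < r y" by (simp add: below_def)
qed

lemma below_self: "w \<in> below w"
  by (simp add: below_def)

lemma below_step: "(z, y) \<in> R \<Longrightarrow> y \<in> below w \<Longrightarrow> z \<in> below w"
  by (simp add: below_def converse_rtrancl_into_rtrancl)

text \<open>The branch starts in \<open>V\<close>, so \<open>u\<close> entered it through its own
  parent edge. Such an edge is in \<open>R\<close> only if \<open>u\<close> has exactly
  \<open>h\<close> neighbours, and then all edges of \<open>u\<close> are in
  \<open>R\<close>.\<close>

lemma below_UN:
  assumes v: "v \<in> V" and u: "u \<in> below v \<inter> U"
  shows "card (N u) = h \<and> N u \<subseteq> below v \<and> card (children u) = h - 1"
proof -
  have "u \<noteq> v" using disj u v by auto
  moreover have "(u, v) \<in> R\<^sup>*" using u by (simp add: below_def)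
  ultimately obtain p where p: "(u, p) \<in> R" "(p, v) \<in> R\<^sup>*"
    by (meson converse_rtranclE)
  then have p': "card (N u) = h" "p \<in> N u" "r p < r u"
    using u disj N_V by (auto simp: R_def)
  have ch: "children u = N u - {p}"
  proof -
    have "p \<notin> children u" using p' by (simp add: children_def)
    then obtain p0 where "p0 \<in> N u" "r p0 < r u" "children u = N u - {p0}"
      using children_cases[of u] p'(2) by blast
    then show ?thesis using p' parent_unique[of p0 u p] by simp
  qed
  have "N u \<subseteq> below v"
  proof
    fix w assume w: "w \<in> N u"
    show "w \<in> below v"
    proof (cases "w = p")
      case True
      then show ?thesis using p by (simp add: below_def)
    next
      case False
      then have "(w, u) \<in> R" using w ch u p' by (auto simp: R_def children_def)
      then show ?thesis using u below_step by blast
    qed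
  qed
  then show ?thesis using p' ch by (simp add: finN)
qed

lemma below_V:
  assumes v: "v \<in> V" and w: "w \<in> below v \<inter> V" "w \<noteq> v"
  shows "\<exists>u\<in>below v \<inter> U. w \<in> children u"
proof -
  have "(w, v) \<in> R\<^sup>*" using w by (simp add: below_def)
  then obtain u where p: "(w, u) \<in> R" "(u, v) \<in> R\<^sup>*"
    using w by (meson converse_rtranclE)
  then show ?thesis using w disj by (intro bexI[of _ u]) (auto simp: R_def below_def children_def)
qed

section \<open>Flow against capacity in a branch\<close>

text \<open>With \<open>j\<close> vertices of \<open>U\<close>, each having \<open>h - 1\<close>
  children, the branch has at most \<open>1 + j * (h - 1)\<close> vertices of \<open>V\<close>. They
  absorb all \<open>j * (h - 1 + \<beta>)\<close> units: \<open>v\<close> takes at most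
  \<open>1 - y\<close> and every other one at most \<open>1\<close>. The terms
  \<open>j * (h - 1)\<close> cancel.\<close>

lemma branch_bound:
  assumes v: "v \<in> V" and y: "(\<Sum>u\<in>below v \<inter> U. x u v) \<le> 1 - y"
  shows "\<beta> * real (card (below v \<inter> U)) \<le> 1 - y"
proof -
  define A where "A = below v \<inter> U"
  define B where "B = below v \<inter> V"
  have finA: "finite A" and finB: "finite B" using fin by (auto simp: A_def B_def)
  have vB: "v \<in> B" using v below_self by (simp add: B_def)
  have "B \<subseteq> insert v (\<Union>u\<in>A. children u)"
    using below_V[OF v] unfolding A_def B_def by blast
  then have "card B \<le> card (insert v (\<Union>u\<in>A. children u))"
    using finA finN by (intro card_mono) (auto simp: children_def)
  also have "\<dots> \<le> Suc (card (\<Union>u\<in>A. children u))"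
    by (simp add: card_insert_le_m1)
  also have "card (\<Union>u\<in>A. children u) \<le> (\<Sum>u\<in>A. card (children u))"
    using finA by (rule card_UN_le)
  also have "\<dots> = card A * (h - 1)"
    using below_UN[OF v] by (simp add: A_def)
  finally have "card B \<le> Suc (card A * (h - 1))" by simp
  then have "real (card B) \<le> real (Suc (card A * (h - 1)))" by (simp only: of_nat_le_iff)
  then have cardB: "real (card B) \<le> 1 + real (card A) * (real h - 1)"
    using h by (simp add: of_nat_diff)
  have "real (card A) * (real h - 1 + \<beta>) = (\<Sum>u\<in>A. \<Sum>w\<in>N u. x u w)"
    using rowN by (simp add: A_def)
  also have "\<dots> \<le> (\<Sum>u\<in>A. \<Sum>w\<in>B. x u w)"
    using below_UN[OF v] N_V finB nonneg
    by (intro sum_mono sum_mono2) (auto simp: A_def B_def)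
  also have "\<dots> = (\<Sum>w\<in>B. \<Sum>u\<in>A. x u w)" by (rule sum.swap)
  also have "\<dots> = (\<Sum>u\<in>A. x u v) + (\<Sum>w\<in>B - {v}. \<Sum>u\<in>A. x u w)"
    using finB vB by (simp add: sum.remove)
  also have "\<dots> \<le> (1 - y) + (\<Sum>w\<in>B - {v}. 1)"
  proof (intro add_mono sum_mono)
    fix w assume w: "w \<in> B - {v}"
    have "(\<Sum>u\<in>A. x u w) \<le> (\<Sum>u\<in>U. x u w)"
      using fin nonneg by (intro sum_mono2) (auto simp: A_def)
    then show "(\<Sum>u\<in>A. x u w) \<le> 1" using col[of w] w by (simp add: B_def)
  qed (use y in \<open>simp add: A_def\<close>)
  also have "(\<Sum>w\<in>B - {v}. 1) = real (card B) - 1"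
    using card.remove[OF finB vB] by simp
  finally have "real (card A) * (real h - 1 + \<beta>) \<le> (1 - y) + real (card A) * (real h - 1)"
    using cardB by linarith
  then show ?thesis by (simp add: A_def algebra_simps)
qed

text \<open>The parent \<open>u\<close> lies outside the branch and occupies \<open>x u v\<close> of
  the capacity of \<open>v\<close>.\<close>

lemma child_bound:
  assumes u: "u \<in> U" and v: "v \<in> children u"
  shows "\<beta> * real (card (below v \<inter> U)) \<le> 1 - x u v"
proof (rule branch_bound)
  show vV: "v \<in> V" using v N_V by (auto simp: children_def)
  have un: "u \<notin> below v"
  proof
    assume "u \<in> below v"
    then show False using below_rank[of u v] v u vV disj by (auto simp: children_def)
  qed
  have "(\<Sum>u'\<in>insert u (below v \<inter> U). x u' v) \<le> (\<Sum>u'\<in>U. x u' v)"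
    using fin nonneg u by (intro sum_mono2) auto
  then show "(\<Sum>u'\<in>below v \<inter> U. x u' v) \<le> 1 - x u v"
    using un fin col[OF vV] by simp
qed

text \<open>The case \<open>y = 0\<close> of \<open>branch_bound\<close>, combined with
  \<open>1 < \<beta> * (k + 1)\<close>.\<close>

lemma top_bound: "v \<in> V \<Longrightarrow> card (below v \<inter> U) \<le> k"
proof -
  assume v: "v \<in> V"
  have "(\<Sum>u'\<in>below v \<inter> U. x u' v) \<le> (\<Sum>u'\<in>U. x u' v)"
    using fin nonneg by (intro sum_mono2) auto
  then have "\<beta> * real (card (below v \<inter> U)) \<le> 1"
    using branch_bound[OF v, of 0] col[OF v] by simp
  then have "\<beta> * real (card (below v \<inter> U)) < \<beta> * (real k + 1)" using \<beta>(2) by simp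
  then show ?thesis using \<beta>(1) by (simp add: mult_less_cancel_left_pos)
qed

text \<open>The size bound is needed only when no parent edge is kept, since only then can
  \<open>u\<close> be the root of its component; \<open>Suc\<close> counts \<open>u\<close>
  itself.\<close>

lemma selection:
  assumes u: "u \<in> U"
  shows "\<exists>K\<subseteq>N u. card K = h \<and> (card (N u) = h \<or> K \<subseteq> children u) \<and>
    (K \<subseteq> children u \<longrightarrow> Suc (\<Sum>v\<in>K. card (below v \<inter> U)) \<le> k)"
proof -
  define j where "j v = card (below v \<inter> U)" for v
  have sumj: "\<beta> * real (sum j (children u)) \<le> real (card (children u)) - (\<Sum>v\<in>children u. x u v)"
  proof -
    have "(\<Sum>v\<in>children u. \<beta> * real (j v)) \<le> (\<Sum>v\<in>children u. 1 - x u v)"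
      using child_bound[OF u] by (intro sum_mono) (simp add: j_def)
    then show ?thesis by (simp add: sum_distrib_left sum_subtractf)
  qed
  show ?thesis
  proof (cases "card (N u) = h")
    case True
    have "Suc (sum j (N u)) \<le> k" if "N u \<subseteq> children u"
    proof -
      have "children u = N u" using that by (auto simp: children_def)
      \<comment> \<open>Here \<open>u\<close> is a root with \<open>h\<close> children, and the
        child bounds add up to \<open>h - (h - 1 + \<beta>) = 1 - \<beta>\<close>.\<close>
      then have "\<beta> * real (Suc (sum j (N u))) \<le> 1"
        using sumj rowN[OF u] True by (simp add: algebra_simps)
      then have "\<beta> * real (Suc (sum j (N u))) < \<beta> * (real k + 1)" using \<beta>(2) by simp
      then have "real (Suc (sum j (N u))) < real k + 1"
        using \<beta>(1) by (simp only: mult_less_cancel_left_pos)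
      then show ?thesis by linarith
    qed
    then show ?thesis using True by (intro exI[of _ "N u"]) (auto simp: j_def)
  next
    case False
    define n where "n = card (N u)"
    have n: "h < n" "n \<le> d"
      using False card_N[OF u] deg[OF u] by (auto simp: n_def N_def)
    have fch: "finite (children u)" using finN by (simp add: children_def)
    have bigN: "real n - real h + 1 \<le> \<beta> * (real k + 1 + (real n - real h - 1) * real q)"
      using big[OF n] .
    \<comment> \<open>This rules out the second alternative of \<open>sum_le_or_total_ge\<close>.
      For a root the strictness comes from one more child, worth \<open>\<beta> * q\<close>;
      otherwise it comes from \<open>x u p < 1\<close> on the dropped parent edge.\<close>
    have key: "h \<le> card (children u) \<and>
        \<beta> * real (sum j (children u)) < \<beta> * (real k + (real (card (children u)) - real h) * real q)"
    proof -
      consider "children u = N u" | p where "p \<in> N u" "r p < r u" "children u = N u - {p}"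
        using children_cases by blast
      then show ?thesis
      proof cases
        case 1
        then have "\<beta> * real (sum j (children u)) \<le> real n - real h + 1 - \<beta>"
          using sumj rowN[OF u] by (simp add: n_def)
        moreover have "0 < \<beta> * real q" using \<beta> q by simp
        ultimately have "\<beta> * real (sum j (children u)) < \<beta> * (real k + (real n - real h) * real q)"
          using bigN by (simp add: algebra_simps)
        then show ?thesis using 1 n by (simp add: n_def)
      next
        case 2
        have c: "real (card (children u)) = real n - 1"
          using 2 finN n by (simp add: n_def of_nat_diff)
        have "(\<Sum>v\<in>children u. x u v) = real h - 1 + \<beta> - x u p"
          using rowN[OF u] 2 finN sum.remove[of "N u" p "x u"] by simp
        moreover have "x u p < 1" using parent_less[of u p] 2 by (simp add: N_def)
        ultimately have "\<beta> * real (sum j (children u)) < real n - real h + 1 - \<beta>"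
          using sumj c by linarith
        then have "\<beta> * real (sum j (children u)) <
            \<beta> * (real k + (real (card (children u)) - real h) * real q)"
          using bigN unfolding c by (simp add: algebra_simps)
        then show ?thesis using c n by linarith
      qed
    qed
    then have lt: "real (sum j (children u)) < real k + (real (card (children u)) - real h) * real q"
      using \<beta>(1) by (simp only: mult_less_cancel_left_pos)
    have "real (sum j (children u)) < real (k + (card (children u) - h) * q)"
      using lt key by (simp only: of_nat_add of_nat_mult of_nat_diff)
    then have "sum j (children u) < k + (card (children u) - h) * q"
      by (simp only: of_nat_less_iff)
    then obtain K where K: "K \<subseteq> children u" "card K = h" "sum j K < k"
      using sum_le_or_total_ge[OF fch _ q(2), of j] key by (meson not_le)
    then show ?thesis by (intro exI[of _ K]) (auto simp: j_def children_def)
  qed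
qed

section \<open>The pruned forest and its components\<close>

text \<open>All vertices of a component climb to one root. Below it lie at most \<open>k\<close>
  vertices of \<open>U\<close>, by \<open>top_bound\<close> or by \<open>selection\<close> according
  to the side of the root, and each contributes \<open>h\<close> edges.\<close>

lemma pruned_matching:
  assumes E: "{{u, v} | u v. 0 < x u v} \<subseteq> E"
  shows "\<exists>F. is_matching U V E h (h * k) F"
proof -
  have "\<forall>u\<in>U. \<exists>K. K \<subseteq> N u \<and> card K = h \<and> (card (N u) = h \<or> K \<subseteq> children u) \<and>
      (K \<subseteq> children u \<longrightarrow> Suc (\<Sum>v\<in>K. card (below v \<inter> U)) \<le> k)"
    using selection by blast
  then obtain K where "\<forall>u\<in>U. K u \<subseteq> N u \<and> card (K u) = h \<and> (card (N u) = h \<or> K u \<subseteq> children u) \<and>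
      (K u \<subseteq> children u \<longrightarrow> Suc (\<Sum>v\<in>K u. card (below v \<inter> U)) \<le> k)"
    by (rule bchoice[elim_format]) blast
  then have KN: "\<And>u. u \<in> U \<Longrightarrow> K u \<subseteq> N u" and cardK: "\<And>u. u \<in> U \<Longrightarrow> card (K u) = h"
    and small: "\<And>u. u \<in> U \<Longrightarrow> card (N u) = h \<or> K u \<subseteq> children u"
    and topK: "\<And>u. u \<in> U \<Longrightarrow> K u \<subseteq> children u \<Longrightarrow> Suc (\<Sum>v\<in>K u. card (below v \<inter> U)) \<le> k"
    by blast+
  have KV: "K u \<subseteq> V" if "u \<in> U" for u using KN[OF that] N_V by blast
  have finK: "finite (K u)" if "u \<in> U" for u using KN[OF that] finN finite_subset by blast
  define F where "F = {{u, v} | u v. u \<in> U \<and> v \<in> K u}"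
  \<comment> \<open>Child-to-parent steps along the kept edges.\<close>
  define P where "P = {(v, u) | u v. u \<in> U \<and> v \<in> K u \<and> r u < r v} \<union>
      {(u, v) | u v. u \<in> U \<and> v \<in> K u \<and> r v < r u}"
  have Fx: "F \<subseteq> {{u, v} | u v. 0 < x u v}" using KN unfolding F_def N_def by blast
  have adjP: "(y, z) \<in> P \<or> (z, y) \<in> P" if yz: "(y, z) \<in> adj_rel F" for y z
  proof -
    obtain u v where uv: "{y, z} = {u, v}" "u \<in> U" "v \<in> K u"
      using yz by (auto simp: adj_rel_def F_def)
    have "r u < r v \<or> r v < r u" using rank_neq[of v u] KN[OF uv(2)] uv(3) by auto
    then show ?thesis using uv by (auto simp: P_def doubleton_eq_iff)
  qed
  have P_rank: "r z < r y" if "(y, z) \<in> P" for y z using that by (auto simp: P_def)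
  have P_unique: "z = z'" if "(y, z) \<in> P" "(y, z') \<in> P" for y z z'
  proof -
    have mem: "\<And>u v. u \<in> U \<Longrightarrow> v \<in> K u \<Longrightarrow> v \<in> N u \<and> v \<in> V \<and> v \<notin> U"
      using KN KV disj by blast
    show ?thesis
      using that mem parent_unique[of z y z'] parent_unique'[of y z z']
      unfolding P_def by blast
  qed
  have P_UV: "y \<in> U \<union> V \<and> z \<in> U \<union> V" if "(y, z) \<in> P" for y z
    using that KV by (auto simp: P_def)
  \<comment> \<open>Climbing lowers the rank, so it ends at a root.\<close>
  have top: "\<exists>t. (w, t) \<in> P\<^sup>* \<and> (\<forall>z. (t, z) \<notin> P)" for w
  proof (induction "r w" arbitrary: w rule: less_induct)
    case less
    show ?case
    proof (cases "\<exists>z. (w, z) \<in> P")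
      case True
      then obtain z where "(w, z) \<in> P" by blast
      then show ?thesis using less[OF P_rank] by (meson converse_rtrancl_into_rtrancl)
    qed blast
  qed
  \<comment> \<open>A neighbour of \<open>y\<close> is a child of \<open>y\<close> or its unique
    parent, which already lies on the path from \<open>y\<close> to \<open>t\<close>.\<close>
  have closed: "(z, t) \<in> P\<^sup>*"
    if t: "\<forall>z. (t, z) \<notin> P" and yt: "(y, t) \<in> P\<^sup>*" and adj: "(y, z) \<in> adj_rel F" for t y z
    using adjP[OF adj]
  proof
    assume yz: "(y, z) \<in> P"
    then have "y \<noteq> t" using t by blast
    then obtain z' where "(y, z') \<in> P" "(z', t) \<in> P\<^sup>*" using yt by (meson converse_rtranclE)
    then show ?thesis using P_unique[OF yz] by simp
  next
    assume "(z, y) \<in> P"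
    then show ?thesis using yt by (rule converse_rtrancl_into_rtrancl)
  qed
  \<comment> \<open>A vertex of \<open>U\<close> on a path ending in \<open>V\<close> keeps its
    parent edge. By \<open>small\<close> it then has exactly \<open>h\<close> neighbours, so the
    path runs in \<open>R\<close>.\<close>
  have belowP: "y \<in> below v" if "(y, v) \<in> P\<^sup>*" "v \<in> V" for y v
    using that(1)
  proof (induction rule: converse_rtrancl_induct)
    case base
    show ?case by (rule below_self)
  next
    case (step y z)
    have "(y, z) \<in> R"
    proof (cases "z \<in> U")
      case True
      then have yz: "y \<in> K z" "r z < r y" using step(1) KV disj by (auto simp: P_def)
      have "z \<noteq> v" using True \<open>v \<in> V\<close> disj by blast
      then obtain p where "(z, p) \<in> P" using step(2) by (meson converse_rtranclE)
      then have "p \<in> K z" "r p < r z" using True KV disj by (auto simp: P_def)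
      then have "card (N z) = h" using small[OF True] by (auto simp: children_def)
      then show ?thesis using True yz KN by (auto simp: R_def)
    next
      case False
      then have yz: "y \<in> U" "z \<in> K y" "r z < r y" using step(1) by (auto simp: P_def)
      then have "card (N y) = h" using small[OF yz(1)] by (auto simp: children_def)
      then show ?thesis using yz KN by (auto simp: R_def)
    qed
    then show ?case using step.IH by (rule below_step)
  qed
  have card_top: "card {y \<in> U. (y, t) \<in> P\<^sup>*} \<le> k" if t: "t \<in> U \<union> V" "\<forall>z. (t, z) \<notin> P" for t
  proof (cases "t \<in> V")
    case True
    then have "{y \<in> U. (y, t) \<in> P\<^sup>*} \<subseteq> below t \<inter> U" using belowP by blast
    then have "card {y \<in> U. (y, t) \<in> P\<^sup>*} \<le> card (below t \<inter> U)"
      using fin by (intro card_mono) auto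
    then show ?thesis using top_bound[OF True] by simp
  next
    case False
    then have tU: "t \<in> U" using t by blast
    \<comment> \<open>A root in \<open>U\<close> keeps no parent edge, so the bound
      \<open>topK\<close> applies to it.\<close>
    have ch: "K t \<subseteq> children t"
    proof
      fix v assume v: "v \<in> K t"
      have "\<not> r v < r t" using t(2) tU v unfolding P_def by blast
      moreover have "v \<in> N t" using v KN[OF tU] by blast
      ultimately show "v \<in> children t"
        using rank_neq[of v t] by (simp add: children_def)
    qed
    have "{y \<in> U. (y, t) \<in> P\<^sup>*} \<subseteq> insert t (\<Union>v\<in>K t. below v \<inter> U)"
    proof
      fix y assume y: "y \<in> {y \<in> U. (y, t) \<in> P\<^sup>*}"
      show "y \<in> insert t (\<Union>v\<in>K t. below v \<inter> U)"
      proof (cases "y = t")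
        case False
        have "(y, t) \<in> P\<^sup>*" using y by blast
        then obtain v where v: "(y, v) \<in> P\<^sup>*" "(v, t) \<in> P"
          using False by (cases rule: rtranclE) auto
        then have vK: "v \<in> K t" using tU KV disj by (auto simp: P_def)
        then have "v \<in> V" using KV[OF tU] by blast
        then show ?thesis using vK belowP[OF v(1)] y by blast
      qed simp
    qed
    then have "card {y \<in> U. (y, t) \<in> P\<^sup>*} \<le> card (insert t (\<Union>v\<in>K t. below v \<inter> U))"
      using fin finK[OF tU] by (intro card_mono) auto
    also have "\<dots> \<le> Suc (card (\<Union>v\<in>K t. below v \<inter> U))" by (simp add: card_insert_le_m1)
    also have "card (\<Union>v\<in>K t. below v \<inter> U) \<le> (\<Sum>v\<in>K t. card (below v \<inter> U))"
      using finK[OF tU] by (rule card_UN_le)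
    finally show ?thesis using topK[OF tU ch] by simp
  qed
  have degree: "degree F u = h" if u: "u \<in> U" for u
  proof -
    have "{e \<in> F. u \<in> e} = (\<lambda>v. {u, v}) ` K u"
      using u KV disj unfolding F_def by auto
    moreover have "inj_on (\<lambda>v. {u, v}) (K u)" by (auto simp: inj_on_def doubleton_eq_iff)
    ultimately show ?thesis using cardK[OF u] by (simp add: degree_def card_image)
  qed
  have comp: "is_tree C (edges_within F C) \<and> card (edges_within F C) \<le> h * k"
    if C: "C \<in> components (U \<union> V) F" for C
  proof
    have "ranked (edges_within F C) r"
      by (rule ranked_mono[OF ranked_mono[OF ranked Fx]]) (auto simp: edges_within_def)
    then show "is_tree C (edges_within F C)"
      unfolding is_tree_def using component_connected[OF C] ranked_no_cycle by blast
    obtain w where w: "w \<in> U \<union> V" "C = (adj_rel F)\<^sup>* `` {w}"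
      using C by (auto simp: components_def)
    obtain t where t: "(w, t) \<in> P\<^sup>*" "\<forall>z. (t, z) \<notin> P" using top by blast
    have tUV: "t \<in> U \<union> V" using t(1) w(1) P_UV by (cases rule: rtranclE) auto
    have "(y, t) \<in> P\<^sup>*" if "(w, y) \<in> (adj_rel F)\<^sup>*" for y
      using that by (induction rule: rtrancl_induct) (use t closed in blast)+
    then have "C \<inter> U \<subseteq> {y \<in> U. (y, t) \<in> P\<^sup>*}" using w by blast
    then have "card (C \<inter> U) \<le> card {y \<in> U. (y, t) \<in> P\<^sup>*}"
      using fin by (intro card_mono) auto
    then have cardC: "card (C \<inter> U) \<le> k" using card_top[OF tUV t(2)] by simp
    have "edges_within F C \<subseteq> (\<Union>u\<in>C \<inter> U. (\<lambda>v. {u, v}) ` K u)"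
      by (auto simp: edges_within_def F_def)
    then have "card (edges_within F C) \<le> card (\<Union>u\<in>C \<inter> U. (\<lambda>v. {u, v}) ` K u)"
      using fin finK by (intro card_mono) auto
    also have "\<dots> \<le> (\<Sum>u\<in>C \<inter> U. card ((\<lambda>v. {u, v}) ` K u))"
      using fin by (intro card_UN_le) auto
    also have "\<dots> \<le> (\<Sum>u\<in>C \<inter> U. h)"
      using cardK finK by (intro sum_mono) (metis IntD2 card_image_le)
    also have "\<dots> \<le> h * k" using cardC by simp
    finally show "card (edges_within F C) \<le> h * k" .
  qed
  have "is_matching U V E h (h * k) F"
    using comp degree Fx E unfolding is_matching_def by blast
  then show ?thesis by blast
qed

end

section \<open>The parameters, and the flow obtained from the expansion hypothesis\<close>

text \<open>
  With \<open>n\<close> for \<open>d\<close> this is an equality.  The fraction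
  \<open>(n - h + 1) / (k + 1 + (n - h - 1) q)\<close> is nondecreasing in \<open>n\<close> because \<open>2 q \<le> k + 1\<close>.
\<close>

lemma fraction_mono:
  fixes k q h n d :: nat and \<beta> :: real
  assumes \<beta>: "\<beta> = (real d - real h + 1) / (real k + 1 + (real d - real h - 1) * real q)"
    and q: "2 * q \<le> k + 1" and n: "h < n" "n \<le> d"
  shows "real n - real h + 1 \<le> \<beta> * (real k + 1 + (real n - real h - 1) * real q)"
proof -
  define a where "a = real n - real h - 1"
  define b where "b = real d - real h - 1"
  have ab: "0 \<le> a" "a \<le> b" using n by (auto simp: a_def b_def)
  define D where "D = real k + 1 + b * real q"
  have D: "0 < D" using ab by (simp add: D_def add_pos_nonneg)
  have "0 \<le> (b - a) * (real k + 1 - 2 * real q)"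
    using ab q by (intro mult_nonneg_nonneg) auto
  then have "(a + 2) * D \<le> (b + 2) * (real k + 1 + a * real q)"
    by (simp add: D_def algebra_simps)
  then have "a + 2 \<le> (b + 2) / D * (real k + 1 + a * real q)"
    using D by (simp add: field_simps)
  moreover have "\<beta> = (b + 2) / D" "real n - real h + 1 = a + 2"
    by (simp_all add: \<beta> a_def b_def D_def)
  ultimately show ?thesis by (simp add: a_def)
qed

theorem theorem1p4:
  fixes k d h :: nat
    and U V :: "'a set"
    and E :: "'a set set"
  assumes "k \<ge> 1" and "d > h" and "h \<ge> 2"
    and "bipartite_graph U V E"
    and "\<forall>u \<in> U. degree E u \<le> d"
    and "\<forall>S \<subseteq> U. real (card (neighbours E S)) \<ge>
      (real h - 1 + (real d - real h + 1) /
        (real k + 1 + (real d - real h - 1) * real_of_int \<lceil>real k / real h\<rceil>)) * real (card S)"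
  shows "\<exists>F. is_matching U V E h (h * k) F"
proof -
  have fin: "finite U" "finite V" and disj: "U \<inter> V = {}"
    and EUV: "E \<subseteq> {{u, v} | u v. u \<in> U \<and> v \<in> V}"
    using assms(4) by (auto simp: bipartite_graph_def)
  define q where "q = nat \<lceil>real k / real h\<rceil>"
  have hpos: "0 < real h" using assms(3) by simp
  have qr: "real q = real_of_int \<lceil>real k / real h\<rceil>"
    unfolding q_def using hpos by simp
  have "real k / real h \<le> real q" "real q < real k / real h + 1"
    unfolding qr by linarith+
  then have "real k \<le> real h * real q" "real h * real q < real k + real h"
    using hpos by (simp_all add: field_simps)
  then have kq: "k \<le> h * q" "h * q < k + h"
    by (simp_all flip: of_nat_mult of_nat_add)
  have q1: "1 \<le> q" using kq(1) assms(1) by (cases q) auto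
  \<comment> \<open>From \<open>h * (q - 1) < k\<close> and \<open>h \<ge> 2\<close>.\<close>
  have q2: "2 * q \<le> k + 1"
  proof -
    obtain p where p: "q = Suc p" using q1 by (cases q) auto
    have "2 * p \<le> h * p" using assms(3) by simp
    moreover have "h * p < k" using kq(2) p by simp
    ultimately have "2 * p < k" by (rule le_less_trans)
    then show ?thesis by (simp add: p)
  qed
  define \<beta> where "\<beta> = (real d - real h + 1) / (real k + 1 + (real d - real h - 1) * real q)"
  have den: "0 < real k + 1 + (real d - real h - 1) * real q"
    using assms(1,2) by (intro add_pos_nonneg mult_nonneg_nonneg) auto
  have \<beta>0: "0 < \<beta>" unfolding \<beta>_def using den assms(2) by (intro divide_pos_pos) auto
  \<comment> \<open>As \<open>q \<le> k + 1\<close>, the denominator of \<open>\<beta>\<close> is at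
    most \<open>(d - h) * (k + 1)\<close>, less than its numerator times
    \<open>k + 1\<close>.\<close>
  have \<beta>1: "1 < \<beta> * (real k + 1)"
  proof -
    have "(real d - real h - 1) * real q \<le> (real d - real h - 1) * (real k + 1)"
      using assms(2) q2 by (intro mult_left_mono) auto
    moreover have "0 < real k + 1" by simp
    ultimately have "real k + 1 + (real d - real h - 1) * real q
        < (real d - real h + 1) * (real k + 1)"
      by (simp add: algebra_simps)
    then show ?thesis using den unfolding \<beta>_def by (simp add: field_simps)
  qed
  define a where "a = real h - 1 + \<beta>"
  have expand: "a * real (card S) \<le> real (card (neighbours E S))" if "S \<subseteq> U" for S
    using assms(6) that unfolding a_def \<beta>_def qr by blast
  have nb: "neighbours E S = {v \<in> V. \<exists>u\<in>S. {u, v} \<in> E}" if "S \<subseteq> U" for S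
  proof -
    have "v \<in> V" if "u \<in> U" "{u, v} \<in> E" for u v
    proof -
      obtain u' v' where "{u, v} = {u', v'}" "u' \<in> U" "v' \<in> V"
        using EUV \<open>{u, v} \<in> E\<close> by blast
      then show ?thesis using \<open>u \<in> U\<close> disj by (auto simp: doubleton_eq_iff)
    qed
    then show ?thesis using \<open>S \<subseteq> U\<close> by (auto simp: neighbours_def)
  qed
  have "hall_cond (\<lambda>u v. {u, v} \<in> E) U V (\<lambda>_. a) (\<lambda>_. 1)"
  proof (rule hall_condI)
    show "0 \<le> a" using assms(3) \<beta>0 by (simp add: a_def)
    show "(\<Sum>u\<in>S. a) \<le> (\<Sum>v\<in>{v \<in> V. \<exists>u\<in>S. {u, v} \<in> E}. 1)" if "S \<subseteq> U" for S
      using expand[OF that] nb[OF that] by (simp add: mult.commute)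
  qed simp
  then obtain x where x: "forest_flow (\<lambda>u v. {u, v} \<in> E) U V (\<lambda>_. a) (\<lambda>_. 1) x"
    using forest_flow_exists[OF fin disj] by blast
  let ?T = "{{u, v} | u v. 0 < x u v}"
  have nonneg: "0 \<le> x u v" for u v using x by (simp add: forest_flow_def)
  have supp: "u \<in> U \<and> v \<in> V \<and> {u, v} \<in> E" if "0 < x u v" for u v
    using x that by (simp add: forest_flow_def)
  have row: "(\<Sum>v\<in>V. x u v) = a" if "u \<in> U" for u using x that by (simp add: forest_flow_def)
  have col: "(\<Sum>u\<in>U. x u v) \<le> 1" if "v \<in> V" for v using x that by (simp add: forest_flow_def)
  \<comment> \<open>A flow of \<open>1\<close> exhausts the capacity of \<open>v\<close>, leaving
    nothing for a second neighbour.\<close>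
  have full: "u' = u" if "x u v = 1" "0 < x u' v" for u u' v
  proof (rule ccontr)
    assume ne: "u' \<noteq> u"
    have "(\<Sum>w\<in>{u, u'}. x w v) \<le> (\<Sum>w\<in>U. x w v)"
      using fin nonneg supp[of u v] supp[of u' v] that by (intro sum_mono2) auto
    then show False using ne that col[of v] supp[of u' v] by auto
  qed
  have "forest ?T" using x by (simp add: forest_flow_def)
  then obtain r0 where r0: "ranked ?T r0" by (auto simp only: forest_def)
  have finT: "finite (r0 ` U)" using fin by simp
  text \<open>A vertex of \<open>V\<close> whose capacity is used up by one neighbour is a leaf; rank it last.\<close>
  define r where "r w = (if \<exists>u. x u w = 1 then Suc (Max (r0 ` U)) else r0 w)" for w
  have rU: "r u = r0 u" if "u \<in> U" for u
  proof -
    have "\<not> x p u = 1" for p using supp[of p u] that disj by fastforce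
    then show ?thesis by (simp add: r_def)
  qed
  \<comment> \<open>A saturated leaf now ranks above all of \<open>U\<close> and is never a parent.
    Hence parent edges carry less than \<open>1\<close>, the strictness that
    \<open>selection\<close> uses.\<close>
  have r0r: "r0 v < r0 u \<and> x u v < 1" if "0 < x u v" "r v < r u" for u v
  proof -
    have uv: "u \<in> U" "v \<in> V" using supp[OF that(1)] by auto
    have "r0 u \<le> Max (r0 ` U)" using finT uv by simp
    moreover have "r v = Suc (Max (r0 ` U))" if "\<exists>p. x p v = 1" using that by (simp add: r_def)
    ultimately have n1: "\<not> (\<exists>p. x p v = 1)" using that(2) rU[OF uv(1)] by fastforce
    have "x u v \<le> (\<Sum>p\<in>U. x p v)" using member_le_sum[of u U "\<lambda>p. x p v"] fin nonneg uv by auto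
    then have "x u v < 1" using col[OF uv(2)] n1 by (metis less_eq_real_def order_trans)
    then show ?thesis using n1 that(2) rU[OF uv(1)] r_def[of v] by simp
  qed
  have edge: "(0 < x p w \<and> p \<in> U \<and> w \<in> V) \<or> (0 < x w p \<and> w \<in> U \<and> p \<in> V)" if "{p, w} \<in> ?T" for p w
    using that supp by (auto simp: doubleton_eq_iff)
  have ranked: "ranked ?T r"
    unfolding ranked_def
  proof (intro conjI allI impI; (elim conjE)?)
    have neq: "r u \<noteq> r v" if "0 < x u v" for u v
    proof -
      have uv: "u \<in> U" using supp[OF that] by auto
      have "r0 u \<le> Max (r0 ` U)" using finT uv by simp
      moreover have "r0 u \<noteq> r0 v" using ranked_neq[OF r0, of u v] that by blast
      ultimately show ?thesis using rU[OF uv] r_def[of v] by auto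
    qed
    show "r p \<noteq> r w" if "{p, w} \<in> ?T" for p w
      using edge[OF that] neq[of p w] neq[of w p] by auto
    fix p y z assume e: "{p, y} \<in> ?T" "{p, z} \<in> ?T" and less: "r y < r p" "r z < r p"
    show "y = z"
    \<comment> \<open>For \<open>p\<close> in \<open>U\<close>, \<open>r0r\<close> takes its parents
      back to \<open>r0\<close>. A saturated \<open>p\<close> in \<open>V\<close> has one neighbour
      by \<open>full\<close>; for any other \<open>p\<close> in \<open>V\<close>, the ranks of
      \<open>p\<close> and its neighbours are unchanged.\<close>
    proof (cases "p \<in> U")
      case True
      then have "0 < x p y" "0 < x p z" using edge[OF e(1)] edge[OF e(2)] disj by auto
      then show ?thesis using r0r less ranked_unique[OF r0 e] by blast
    next
      case False
      then have yz: "0 < x y p" "0 < x z p" "y \<in> U" "z \<in> U"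
        using edge[OF e(1)] edge[OF e(2)] by auto
      show ?thesis
      proof (cases "\<exists>u. x u p = 1")
        case True
        then show ?thesis using full yz by metis
      next
        case False
        then have "r p = r0 p" unfolding r_def by (rule if_not_P)
        then show ?thesis using ranked_unique[OF r0 e] less rU yz by simp
      qed
    qed
  qed
  have deg: "card {v \<in> V. 0 < x u v} \<le> d" if u: "u \<in> U" for u
  proof -
    have "finite E"
      by (rule finite_subset[of _ "Pow (U \<union> V)"]) (use EUV fin in auto)
    then have "card ((\<lambda>v. {u, v}) ` {v \<in> V. 0 < x u v}) \<le> degree E u"
      unfolding degree_def using supp by (intro card_mono) auto
    moreover have "inj_on (\<lambda>v. {u, v}) {v \<in> V. 0 < x u v}"
      by (auto simp: inj_on_def doubleton_eq_iff)
    ultimately show ?thesis using assms(5) u by (fastforce simp: card_image)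
  qed
  have TE: "?T \<subseteq> E" using supp by blast
  interpret ranked_flow U V x r h k q d \<beta>
  proof
    show "real n - real h + 1 \<le> \<beta> * (real k + 1 + (real n - real h - 1) * real q)"
      if "h < n" "n \<le> d" for n
      using fraction_mono[OF \<beta>_def q2 that] .
    show "x u v < 1" if "0 < x u v" "r v < r u" for u v using r0r[OF that] by blast
  qed (use fin disj nonneg supp row col ranked deg assms(3) \<beta>0 \<beta>1 q1 kq(2) in \<open>auto simp: a_def\<close>)
  show ?thesis using TE by (rule pruned_matching)
qed

end
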